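(* For every $N\ge1$ and every cyclic sentence $S$ of length $N$ in the letters $\{A,X,B\}$, one has $|S|=|\overline S|$, where $\overline S$ is the cyclic sentence obtained by reversing $S$.
   Context: A cyclic sentence of length $N$ is a string of length $N$ in the letters $A,X,B$ considered up to cyclic permutation (its letters sit at $N$ positions around a circle). The following words are assigned a coefficient and a weight: $X$ (coefficient $1$, weight $0$); $XA$ ($1$, $1$); $XAA$ ($1$, $1$); $XBA$ ($1$, $1$); $AXA$ ($2$, $1$); $AAA$ ($-1$, $1$); $BA$ ($-1$, $1$); $ABA$ ($-1$, $1$); $XXA$ ($-2$, $1$). A parsing of a cyclic sentence is a decomposition of the cyclic string (cut at some positions around the circle) into consecutive blocks each of which is one of these words. The coefficient of a parsing is the product of the coefficients of its words and its weight is the sum of their weights. $c(S,w)$ is the sum of the coefficients of all parsings of $S$ of weight $w$, and $|S|=\sum_{w\ge0}c(S,w)t^w$, a polynomial in $t$. For example, $(ABAXA)$ has exactly the parsings $ABA/XA$ and $XAA/BA$ (cyclically), so $|(ABAXA)|=-2t^2$. *)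

theory Defs
  imports "HOL-Computational_Algebra.Polynomial" "HOL-Number_Theory.Cong"
begin

datatype letter = A | X | B

definition rotation_equiv :: "letter list \<Rightarrow> letter list \<Rightarrow> bool" where
  "rotation_equiv s s' \<longleftrightarrow> (\<exists>n. s' = rotate n s)"

lemma rotate_back: "rotate (length s - n mod length s) (rotate n s) = s"
proof (cases "s = []")
  case False
  then have "n mod length s < length s" by simp
  moreover have "rotate n s = rotate (n mod length s) s" by (rule rotate_conv_mod)
  ultimately show ?thesis by (simp add: rotate_rotate)
qed simp

lemma equivp_rotation_equiv: "equivp rotation_equiv"
proof (rule equivpI)
  show "reflp rotation_equiv"
    unfolding rotation_equiv_def by (auto intro!: reflpI exI[of _ 0])
  show "symp rotation_equiv"
  proof (rule sympI)
    fix s s' assume "rotation_equiv s s'"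
    then obtain n where s': "s' = rotate n s"
      unfolding rotation_equiv_def by blast
    have "rotate (length s - n mod length s) s' = s"
      unfolding s' by (rule rotate_back)
    then show "rotation_equiv s' s"
      unfolding rotation_equiv_def by metis
  qed
  show "transp rotation_equiv"
    unfolding rotation_equiv_def by (auto intro!: transpI simp: rotate_rotate)
qed

quotient_type cyclic_sentence = "letter list" / rotation_equiv
  by (rule equivp_rotation_equiv)

lift_definition sentence_length :: "cyclic_sentence \<Rightarrow> nat" is length
  by (auto simp: rotation_equiv_def)

lift_definition reversed :: "cyclic_sentence \<Rightarrow> cyclic_sentence" is rev
proof -
  fix s s' assume "rotation_equiv s s'"
  then obtain n where s': "s' = rotate n s"
    unfolding rotation_equiv_def by blast
  have "rotate n (rev s') = rev s"
    by (simp add: rotate_rev s' rotate_back)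
  then have "rotation_equiv (rev s') (rev s)"
    unfolding rotation_equiv_def by metis
  then show "rotation_equiv (rev s) (rev s')"
    using equivp_rotation_equiv equivp_symp by metis
qed

definition vocabulary :: "(letter list \<times> int \<times> nat) list" where
  "vocabulary =
    [([X], 1, 0),
     ([X, A], 1, 1),
     ([X, A, A], 1, 1),
     ([X, B, A], 1, 1),
     ([A, X, A], 2, 1),
     ([A, A, A], -1, 1),
     ([B, A], -1, 1),
     ([A, B, A], -1, 1),
     ([X, X, A], -2, 1)]"

definition is_word :: "letter list \<Rightarrow> bool" where
  "is_word u \<longleftrightarrow> u \<in> fst ` set vocabulary"

definition word_coeff :: "letter list \<Rightarrow> int" where
  "word_coeff u = fst (the (map_of vocabulary u))"

definition word_weight :: "letter list \<Rightarrow> nat" where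
  "word_weight u = snd (the (map_of vocabulary u))"

text \<open>
  The positions of a string \<open>s\<close> around the circle are the residues \<open>0, \<dots>, length s - 1\<close>.
  A decomposition of the circle is encoded by the nonempty set \<open>C\<close> of the positions at which
  its blocks start, a cut being made just before each of them.  If \<open>C\<close> has a single element,
  the only block is the whole circle read from there.
\<close>

definition block_length :: "nat \<Rightarrow> nat set \<Rightarrow> nat \<Rightarrow> nat" where
  "block_length N C c = (LEAST d. 0 < d \<and> (c + d) mod N \<in> C)"

definition block :: "letter list \<Rightarrow> nat set \<Rightarrow> nat \<Rightarrow> letter list" where
  "block s C c = map (\<lambda>i. s ! ((c + i) mod length s)) [0..<block_length (length s) C c]"

definition parsings :: "letter list \<Rightarrow> nat set set" where
  "parsings s = {C. C \<noteq> {} \<and> C \<subseteq> {..<length s} \<and> (\<forall>c\<in>C. is_word (block s C c))}"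

definition parsing_coeff :: "letter list \<Rightarrow> nat set \<Rightarrow> int" where
  "parsing_coeff s C = (\<Prod>c\<in>C. word_coeff (block s C c))"

definition parsing_weight :: "letter list \<Rightarrow> nat set \<Rightarrow> nat" where
  "parsing_weight s C = (\<Sum>c\<in>C. word_weight (block s C c))"

lemma shift_mem_iff:
  fixes N n x :: nat
  assumes "C \<subseteq> {..<N}" "x < N"
  shows "(x + n) mod N \<in> (\<lambda>c. (c + n) mod N) ` C \<longleftrightarrow> x \<in> C"
proof
  assume "(x + n) mod N \<in> (\<lambda>c. (c + n) mod N) ` C"
  then obtain c where c: "c \<in> C" "(x + n) mod N = (c + n) mod N" by blast
  then have "[x = c] (mod N)"
    unfolding cong_def[symmetric] by (simp only: cong_add_rcancel_nat)
  then have "x mod N = c mod N"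
    by (simp add: cong_def)
  moreover have "c < N" using c assms by auto
  ultimately show "x \<in> C" using c assms by simp
qed blast

lemma block_rotate:
  assumes "C \<subseteq> {..<length s}" "c \<in> C"
  shows "block s ((\<lambda>c. (c + n) mod length s) ` C) ((c + n) mod length s)
    = block (rotate n s) C c"
proof -
  let ?N = "length s"
  have N: "?N > 0" using assms by auto
  have "((c + n) mod ?N + d) mod ?N \<in> (\<lambda>c. (c + n) mod ?N) ` C \<longleftrightarrow> (c + d) mod ?N \<in> C" for d
  proof -
    have "((c + n) mod ?N + d) mod ?N = ((c + d) mod ?N + n) mod ?N"
      by (simp add: mod_simps ac_simps)
    then show ?thesis using shift_mem_iff[OF assms(1), of "(c + d) mod ?N" n] N by simp
  qed
  then have "block_length ?N ((\<lambda>c. (c + n) mod ?N) ` C) ((c + n) mod ?N) = block_length ?N C c"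
    unfolding block_length_def by simp
  then show ?thesis
    unfolding block_def using N by (simp add: nth_rotate mod_simps ac_simps)
qed

lemma inj_on_shift: "inj_on (\<lambda>c. (c + n) mod N) {..<N::nat}"
proof (rule inj_onI)
  fix x y assume "x \<in> {..<N}" "y \<in> {..<N}" "(x + n) mod N = (y + n) mod N"
  then show "x = y" using shift_mem_iff[of "{y}" N x n] by auto
qed

lemma shift_image: "(\<lambda>c. (c + n) mod N) ` {..<N::nat} = {..<N}"
  by (rule endo_inj_surj) (auto simp: inj_on_shift)

lemma bij_betw_parsings_rotate:
  "bij_betw (\<lambda>C. (\<lambda>c. (c + n) mod length s) ` C) (parsings (rotate n s)) (parsings s)"
proof -
  let ?f = "\<lambda>c. (c + n) mod length s"
  have bij: "bij_betw ((`) ?f) (Pow {..<length s}) (Pow {..<length s})"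
    by (rule bij_betw_Pow) (simp add: bij_betw_def inj_on_shift shift_image)
  have iff: "?f ` C \<in> parsings s \<longleftrightarrow> C \<in> parsings (rotate n s)"
    if C: "C \<in> Pow {..<length s}" for C
  proof -
    have "?f ` C \<subseteq> {..<length s}" using C shift_image[of n "length s"] by blast
    then show ?thesis using C by (auto simp: parsings_def block_rotate)
  qed
  have sub: "parsings u \<subseteq> Pow {..<length u}" for u by (auto simp: parsings_def)
  show ?thesis
    unfolding bij_betw_def
  proof
    show "inj_on ((`) ?f) (parsings (rotate n s))"
      using bij sub[of "rotate n s"] by (auto simp: bij_betw_def intro: inj_on_subset)
    show "((`) ?f) ` parsings (rotate n s) = parsings s"
    proof
      show "((`) ?f) ` parsings (rotate n s) \<subseteq> parsings s"
        using iff sub[of "rotate n s"] by auto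
      show "parsings s \<subseteq> ((`) ?f) ` parsings (rotate n s)"
      proof
        fix D assume D: "D \<in> parsings s"
        then obtain C where "C \<in> Pow {..<length s}" "D = ?f ` C"
          using bij sub[of s] unfolding bij_betw_def by (metis imageE subsetD)
        then show "D \<in> ((`) ?f) ` parsings (rotate n s)" using iff D by blast
      qed
    qed
  qed
qed

lemma parsing_rotate:
  assumes "C \<in> parsings (rotate n s)"
  shows "parsing_coeff s ((\<lambda>c. (c + n) mod length s) ` C) = parsing_coeff (rotate n s) C"
    and "parsing_weight s ((\<lambda>c. (c + n) mod length s) ` C) = parsing_weight (rotate n s) C"
proof -
  have C: "C \<subseteq> {..<length s}" using assms by (auto simp: parsings_def)
  then have inj: "inj_on (\<lambda>c. (c + n) mod length s) C" by (rule inj_on_subset[OF inj_on_shift])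
  show "parsing_coeff s ((\<lambda>c. (c + n) mod length s) ` C) = parsing_coeff (rotate n s) C"
    unfolding parsing_coeff_def using C
    by (subst prod.reindex[OF inj]) (auto intro!: prod.cong simp: block_rotate)
  show "parsing_weight s ((\<lambda>c. (c + n) mod length s) ` C) = parsing_weight (rotate n s) C"
    unfolding parsing_weight_def using C
    by (subst sum.reindex[OF inj]) (auto intro!: sum.cong simp: block_rotate)
qed

lemma bij_betw_Collect:
  assumes "bij_betw f P Q" "\<And>x. x \<in> P \<Longrightarrow> q (f x) \<longleftrightarrow> p x"
  shows "bij_betw f {x \<in> P. p x} {y \<in> Q. q y}"
  using assms by (auto simp: bij_betw_def inj_on_def)

lift_definition weight_coeff :: "cyclic_sentence \<Rightarrow> nat \<Rightarrow> int" is
  "\<lambda>s w. \<Sum>C \<in> {C \<in> parsings s. parsing_weight s C = w}. parsing_coeff s C"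
proof -
  fix s s' assume "rotation_equiv s s'"
  then obtain n where s': "s' = rotate n s" unfolding rotation_equiv_def by blast
  let ?F = "\<lambda>C. (\<lambda>c. (c + n) mod length s) ` C"
  show "(\<lambda>w. \<Sum>C \<in> {C \<in> parsings s. parsing_weight s C = w}. parsing_coeff s C) =
        (\<lambda>w. \<Sum>C \<in> {C \<in> parsings s'. parsing_weight s' C = w}. parsing_coeff s' C)"
  proof
    fix w
    have "bij_betw ?F {C \<in> parsings s'. parsing_weight s' C = w}
        {C \<in> parsings s. parsing_weight s C = w}"
      unfolding s' using bij_betw_parsings_rotate
      by (rule bij_betw_Collect) (simp add: parsing_rotate)
    then show "(\<Sum>C \<in> {C \<in> parsings s. parsing_weight s C = w}. parsing_coeff s C) =
        (\<Sum>C \<in> {C \<in> parsings s'. parsing_weight s' C = w}. parsing_coeff s' C)"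
      by (rule sum.reindex_bij_betw[symmetric, THEN trans])
        (auto intro!: sum.cong simp: s' parsing_rotate)
  qed
qed

text \<open>
  Every word has weight at most 1, so no parsing has weight exceeding the length of the sentence
  and the sum below contains all nonzero terms; see the lemma \<open>coeff_sentence_poly\<close>.
\<close>

definition sentence_poly :: "cyclic_sentence \<Rightarrow> int poly" where
  "sentence_poly S = (\<Sum>w\<le>sentence_length S. monom (weight_coeff S w) w)"

lemma word_weight_le: "is_word u \<Longrightarrow> word_weight u \<le> 1"
  by (auto simp: is_word_def word_weight_def vocabulary_def)

lemma parsing_weight_le:
  assumes "C \<in> parsings s"
  shows "parsing_weight s C \<le> length s"
proof -
  have "word_weight (block s C c) \<le> 1" if "c \<in> C" for c
    using assms that by (auto simp: parsings_def intro!: word_weight_le[simplified])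
  then have "parsing_weight s C \<le> card C"
    using sum_bounded_above[of C "\<lambda>c. word_weight (block s C c)" 1]
    by (simp add: parsing_weight_def)
  also have "\<dots> \<le> card {..<length s}"
    using assms by (intro card_mono) (auto simp: parsings_def)
  finally show ?thesis by simp
qed

lemma weight_coeff_eq_0: "sentence_length S < w \<Longrightarrow> weight_coeff S w = 0"
proof (transfer, goal_cases)
  case (1 s w)
  then have "{C \<in> parsings s. parsing_weight s C = w} = {}"
    using parsing_weight_le by fastforce
  then show ?case by (simp only: sum.empty)
qed

lemma coeff_sentence_poly: "coeff (sentence_poly S) w = weight_coeff S w"
  by (auto simp: sentence_poly_def coeff_sum weight_coeff_eq_0)

end

theory Submission
  imports Defs "HOL-Analysis.Determinants"
begin

text \<open>
  The coefficients of the words of length three factor over their letters, so \<open>|S|\<close> is the trace of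
  the product of \<open>3 \<times> 3\<close> transfer matrices \<open>M l\<close> over \<open>\<int>[t]\<close>, one for each letter \<open>l\<close> of \<open>S\<close>.
  There is a single symmetric matrix \<open>P\<close> of nonzero determinant that satisfies \<open>P (M l) = (M l)\<^sup>T P\<close>
  for all three letters.  Hence conjugation by \<open>P\<close> turns the product along \<open>S\<close> into the
  transpose of the product along the reversed sentence, and the two traces agree.
\<close>

section \<open>Matrix products along a list, walks and traces\<close>

definition word_matrix :: "('a \<Rightarrow> 'b::comm_ring_1^'n^'n) \<Rightarrow> 'a list \<Rightarrow> 'b^'n^'n" where
  "word_matrix M s = foldl (\<lambda>P l. P ** M l) (mat 1) s"

lemma word_matrix_Nil [simp]: "word_matrix M [] = mat 1"
  by (simp add: word_matrix_def)

lemma word_matrix_snoc [simp]: "word_matrix M (s @ [l]) = word_matrix M s ** M l"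
  by (simp add: word_matrix_def)

text \<open>The recursion at the front serves reversed lists, since \<open>rev\<close> moves the
  last letter to the front.\<close>

lemma word_matrix_Cons: "word_matrix M (l # s) = M l ** word_matrix M s"
proof (induction s rule: rev_induct)
  case Nil
  then show ?case using word_matrix_snoc[of M "[]" l] by simp
next
  case (snoc k s)
  then show ?case using word_matrix_snoc[of M "l # s" k] by (simp add: matrix_mul_assoc)
qed

text \<open>Path expansion of a matrix product: a walk \<open>f\<close> gives the state before each
  letter and after the last one. Extensional functions give one representative per walk and a finite
  index set.\<close>

lemma word_matrix_entry:
  fixes M :: "'a \<Rightarrow> 'b::comm_ring_1^'n::finite^'n"
  shows "word_matrix M s $ i $ j =
    (\<Sum>f | f \<in> {..length s} \<rightarrow>\<^sub>E UNIV \<and> f 0 = i \<and> f (length s) = j.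
      \<Prod>k<length s. M (s ! k) $ f k $ f (Suc k))"
proof (induction s arbitrary: j rule: rev_induct)
  case Nil
  show ?case
  proof (cases "i = j")
    case True
    have "{f. f \<in> {..0::nat} \<rightarrow>\<^sub>E (UNIV::'n set) \<and> f 0 = i \<and> f 0 = j} = {\<lambda>k. if k = 0 then j else undefined}"
      using True by (auto simp: PiE_iff extensional_def fun_eq_iff)
    then show ?thesis using True by (simp add: mat_def)
  next
    case False
    then have "{f. f \<in> {..0::nat} \<rightarrow>\<^sub>E (UNIV::'n set) \<and> f 0 = i \<and> f 0 = j} = {}" by auto
    then show ?thesis using False by (simp add: mat_def del: Collect_empty_eq)
  qed
next
  case (snoc l s)
  let ?n = "length s"
  let ?W = "{f. f \<in> {..?n} \<rightarrow>\<^sub>E (UNIV::'n set) \<and> f 0 = i}"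
  let ?w = "\<lambda>f. (\<Prod>k<?n. M (s ! k) $ f k $ f (Suc k))"
  have "finite ({..?n} \<rightarrow>\<^sub>E (UNIV::'n set))" by (rule finite_PiE) auto
  then have fin: "finite ?W" by (rule rev_finite_subset) auto
  have "word_matrix M (s @ [l]) $ i $ j = (\<Sum>k\<in>UNIV. word_matrix M s $ i $ k * M l $ k $ j)"
    by (simp add: matrix_matrix_mult_def)
  \<comment> \<open>Writing the intermediate index \<open>k\<close> as the last state of the shorter
    walk lets the double sum collapse to one over all walks from \<open>i\<close>.\<close>
  also have "\<dots> = (\<Sum>k\<in>UNIV. \<Sum>f | f \<in> ?W \<and> f ?n = k. ?w f * M l $ f ?n $ j)"
    unfolding snoc sum_distrib_right by (intro sum.cong) auto
  also have "\<dots> = (\<Sum>f\<in>?W. ?w f * M l $ f ?n $ j)"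
    by (rule sum.group) (use fin in auto)
  also have "\<dots> = (\<Sum>f | f \<in> {..Suc ?n} \<rightarrow>\<^sub>E UNIV \<and> f 0 = i \<and> f (Suc ?n) = j.
      \<Prod>k<Suc ?n. M ((s @ [l]) ! k) $ f k $ f (Suc k))"
  \<comment> \<open>Walks over \<open>s\<close> match walks over \<open>s @ [l]\<close> ending in
    \<open>j\<close> by attaching or forgetting the final state.\<close>
  proof (rule sum.reindex_bij_witness[where i = "\<lambda>f. restrict f {..?n}" and j = "\<lambda>f. f(Suc ?n := j)"])
    fix f assume f: "f \<in> ?W"
    then show "restrict (f(Suc ?n := j)) {..?n} = f"
      by (auto simp: PiE_iff extensional_def fun_eq_iff)
    show "f(Suc ?n := j) \<in> {f. f \<in> {..Suc ?n} \<rightarrow>\<^sub>E UNIV \<and> f 0 = i \<and> f (Suc ?n) = j}"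
      using f by (auto simp: PiE_iff extensional_def)
    have "?w (f(Suc ?n := j)) = ?w f"
      by (intro prod.cong) auto
    moreover have "(\<Prod>k<?n. M ((s @ [l]) ! k) $ (f(Suc ?n := j)) k $ (f(Suc ?n := j)) (Suc k)) = ?w (f(Suc ?n := j))"
      by (intro prod.cong) (auto simp: nth_append)
    ultimately show "(\<Prod>k<Suc ?n. M ((s @ [l]) ! k) $ (f(Suc ?n := j)) k $ (f(Suc ?n := j)) (Suc k)) =
        ?w f * M l $ f ?n $ j"
      by simp
  next
    fix f assume f: "f \<in> {f. f \<in> {..Suc ?n} \<rightarrow>\<^sub>E (UNIV::'n set) \<and> f 0 = i \<and> f (Suc ?n) = j}"
    then show "(restrict f {..?n})(Suc ?n := j) = f"
      by (auto simp: PiE_iff extensional_def fun_eq_iff)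
    show "restrict f {..?n} \<in> ?W"
      using f by auto
  qed
  finally show ?case by simp
qed

lemma trace_word_matrix:
  fixes M :: "'a \<Rightarrow> 'b::comm_ring_1^'n::finite^'n"
  shows "trace (word_matrix M s) =
    (\<Sum>f | f \<in> {..length s} \<rightarrow>\<^sub>E UNIV \<and> f (length s) = f 0.
      \<Prod>k<length s. M (s ! k) $ f k $ f (Suc k))"
proof -
  let ?W = "{f. f \<in> {..length s} \<rightarrow>\<^sub>E (UNIV::'n set) \<and> f (length s) = f 0}"
  have "finite ({..length s} \<rightarrow>\<^sub>E (UNIV::'n set))" by (rule finite_PiE) auto
  then have fin: "finite ?W" by (rule rev_finite_subset) auto
  have "trace (word_matrix M s) = (\<Sum>i\<in>UNIV. \<Sum>f | f \<in> ?W \<and> f 0 = i.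
      \<Prod>k<length s. M (s ! k) $ f k $ f (Suc k))"
    unfolding trace_def word_matrix_entry by (intro sum.cong) auto
  also have "\<dots> = (\<Sum>f\<in>?W. \<Prod>k<length s. M (s ! k) $ f k $ f (Suc k))"
    by (rule sum.group) (use fin in auto)
  finally show ?thesis .
qed

text \<open>Over a domain \<open>P\<close> need not be invertible; \<open>R\<close> inverts it up to
  the scalar \<open>d\<close>, which is cancelled from the traces at the end.\<close>

lemma trace_word_matrix_rev:
  fixes M :: "'a \<Rightarrow> 'b::idom^'n::finite^'n"
  assumes sym: "\<And>l. P ** M l = transpose (M l) ** P"
    and inverse: "P ** R = mat d" "R ** P = mat d" and "d \<noteq> 0"
  shows "trace (word_matrix M (rev s)) = trace (word_matrix M s)"
proof -
  have trace_mat: "trace (mat d ** Q) = d * trace Q" for Q :: "'b^'n^'n"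
    by (simp add: trace_def matrix_matrix_mult_def mat_def sum_distrib_left if_distrib[of "\<lambda>x. x * _"] cong: if_cong)
  have PM: "P ** word_matrix M s = transpose (word_matrix M (rev s)) ** P"
  proof (induction s rule: rev_induct)
    case Nil
    show ?case by (simp add: transpose_mat)
  next
    case (snoc l s)
    have "P ** word_matrix M (s @ [l]) = (P ** word_matrix M s) ** M l"
      by (simp add: matrix_mul_assoc)
    also have "\<dots> = transpose (word_matrix M (rev s)) ** (P ** M l)"
      by (simp add: snoc matrix_mul_assoc)
    also have "\<dots> = transpose (word_matrix M (rev (s @ [l]))) ** P"
      by (simp add: sym word_matrix_Cons matrix_transpose_mul matrix_mul_assoc)
    finally show ?case .
  qed
  have "d * trace (word_matrix M s) = trace (R ** (P ** word_matrix M s))"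
    by (simp add: matrix_mul_assoc inverse trace_mat)
  \<comment> \<open>\<open>PM\<close> leaves \<open>P\<close> at the right end; cyclicity of the
    trace carries it round to meet \<open>R\<close>.\<close>
  also have "\<dots> = trace ((P ** R) ** transpose (word_matrix M (rev s)))"
    unfolding PM by (metis matrix_mul_assoc trace_mul_sym)
  also have "\<dots> = d * trace (word_matrix M (rev s))"
    unfolding inverse trace_mat by (simp add: trace_def transpose_def)
  finally show ?thesis using \<open>d \<noteq> 0\<close> by simp
qed

section \<open>Transfer matrices for the vocabulary\<close>

text \<open>
  The state records how many letters of the current block are still to be read.
\<close>

datatype state = Cut | One | Two

lemma UNIV_state: "UNIV = {Cut, One, Two}"
  using state.exhaust by auto

instance state :: finite
  by standard (simp add: UNIV_state)

fun state_of :: "nat \<Rightarrow> state" where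
  "state_of 0 = Cut"
| "state_of (Suc 0) = One"
| "state_of (Suc (Suc _)) = Two"

text \<open>
  Only three states are needed because the coefficients of the words of length three factor:
  the word consisting of \<open>k\<close>, \<open>l\<close> and \<open>A\<close> has coefficient \<open>a k * b l\<close> with \<open>a X = 1\<close>,
  \<open>a A = -1\<close>, \<open>a B = 0\<close> and \<open>b A = b B = 1\<close>, \<open>b X = -2\<close>.
\<close>

fun step :: "letter \<Rightarrow> state \<Rightarrow> state \<Rightarrow> int poly" where
  "step X Cut Cut = 1"
| "step X Cut One = [:0, 1:]"
| "step X Cut Two = [:0, 1:]"
| "step X Two One = -2"
| "step A Cut Two = [:0, -1:]"
| "step A One Cut = 1"
| "step A Two One = 1"
| "step B Cut One = [:0, -1:]"
| "step B Two One = 1"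
| "step _ _ _ = 0"

definition transfer :: "letter \<Rightarrow> int poly^state^state" where
  "transfer l = (\<chi> i j. step l i j)"

definition word_poly :: "letter list \<Rightarrow> int poly" where
  "word_poly u = (if is_word u then monom (word_coeff u) (word_weight u) else 0)"

text \<open>The start of a block has state \<open>Cut\<close> because it is also the end of the
  previous block. Up to three letters this is a finite check. Since \<open>state_of\<close>
  saturates at \<open>Two\<close>, a longer block has a step from \<open>Two\<close> to
  \<open>Two\<close>, which vanishes, and no word is that long.\<close>

lemma prod_step_eq_word_poly:
  assumes "u \<noteq> []"
  shows "(\<Prod>j<length u. step (u ! j) (if j = 0 then Cut else state_of (length u - j))
      (state_of (length u - Suc j))) = word_poly u"
proof -
  consider a where "u = [a]" | a b where "u = [a, b]" | a b c where "u = [a, b, c]"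
    | a b c d v where "u = a # b # c # d # v"
    using assms by (metis list.exhaust)
  then show ?thesis
  proof cases
    case 1
    then show ?thesis
      by (cases a) (simp_all add: word_poly_def is_word_def word_coeff_def word_weight_def
          vocabulary_def monom_altdef)
  next
    case 2
    then show ?thesis
      by (cases a; cases b) (simp_all add: word_poly_def is_word_def word_coeff_def word_weight_def
          vocabulary_def monom_altdef lessThan_Suc)
  next
    case 3
    then show ?thesis
      by (cases a; cases b; cases c) (simp_all add: word_poly_def is_word_def word_coeff_def
          word_weight_def vocabulary_def monom_altdef lessThan_Suc numeral_poly)
  next
    case 4
    have "step (u ! 1) Two Two = 0" by (cases "u ! 1") auto
    then have "step (u ! 1) (if (1::nat) = 0 then Cut else state_of (length u - 1))
        (state_of (length u - Suc 1)) = 0"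
      using 4 by simp
    moreover have "1 \<in> {..<length u}" using 4 by simp
    ultimately have "(\<Prod>j<length u. step (u ! j) (if j = 0 then Cut else state_of (length u - j))
        (state_of (length u - Suc j))) = 0"
      by (metis (no_types, lifting) finite_lessThan prod_zero)
    moreover have "\<not> is_word u"
      using 4 by (auto simp: is_word_def vocabulary_def)
    ultimately show ?thesis by (simp add: word_poly_def)
  qed
qed

section \<open>Cuts around the circle and their blocks\<close>

text \<open>Unlike in \<open>block_length\<close>, distance 0 is allowed: a position that is itself
  a cut must get the state \<open>Cut\<close>.\<close>

definition cut_distance :: "nat \<Rightarrow> nat set \<Rightarrow> nat \<Rightarrow> nat" where
  "cut_distance N C i = (LEAST d. (i + d) mod N \<in> C)"

lemma cut_distance_mod [simp]: "cut_distance N C (i mod N) = cut_distance N C i"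
  by (simp add: cut_distance_def mod_simps)

lemma cut_distance_Suc_mod [simp]: "cut_distance N C (Suc (i mod N)) = cut_distance N C (Suc i)"
proof -
  have "(Suc (i mod N) + d) mod N = (Suc i + d) mod N" for d
    by (metis add_Suc_shift mod_add_left_eq)
  then show ?thesis by (simp only: cut_distance_def)
qed

context
  fixes N :: nat and C :: "nat set"
  assumes nonempty: "C \<noteq> {}" and bound: "C \<subseteq> {..<N}"
begin

lemma ex_cut_after: "\<exists>d>0. (i + d) mod N \<in> C"
proof -
  obtain c where c: "c \<in> C" "c < N" using nonempty bound by auto
  have less: "i mod N < N" using c by simp
  \<comment> \<open>The witness runs to the end of the circle and then on to \<open>c\<close>; its
    first part is positive, hence so is the distance.\<close>
  have "(i + (N - i mod N + c)) mod N = (i mod N + (N - i mod N + c)) mod N"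
    by (simp add: mod_simps)
  also have "\<dots> = (N + c) mod N" using less by (intro arg_cong[of _ _ "\<lambda>x. x mod N"]) simp
  also have "\<dots> = c" using c by simp
  finally have "(i + (N - i mod N + c)) mod N \<in> C" using c by (simp only:)
  moreover have "0 < N - i mod N + c" using less by simp
  ultimately show ?thesis by blast
qed

lemma block_length_pos: "0 < block_length N C c"
  and block_length_cut: "(c + block_length N C c) mod N \<in> C"
  using LeastI_ex[OF ex_cut_after[of c]] by (auto simp: block_length_def)

lemma no_cut_in_block:
  assumes "0 < d" "(c + d) mod N \<in> C"
  shows "block_length N C c \<le> d"
  unfolding block_length_def using assms by (intro Least_le) simp

lemma cut_distance_eq_0_iff: "cut_distance N C i = 0 \<longleftrightarrow> i mod N \<in> C"
proof
  assume "cut_distance N C i = 0"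
  moreover have "(i + cut_distance N C i) mod N \<in> C"
    unfolding cut_distance_def using ex_cut_after[of i]
    by (intro LeastI_ex[of "\<lambda>d. (i + d) mod N \<in> C"]) blast
  ultimately show "i mod N \<in> C" by simp
next
  assume "i mod N \<in> C"
  then show "cut_distance N C i = 0" by (simp add: cut_distance_def)
qed

lemma cut_distance_in_block:
  assumes "0 < j" "j \<le> block_length N C c"
  shows "cut_distance N C (c + j) = block_length N C c - j"
  unfolding cut_distance_def
proof (rule Least_equality)
  show "(c + j + (block_length N C c - j)) mod N \<in> C"
    using block_length_cut assms by simp
  show "block_length N C c - j \<le> d" if "(c + j + d) mod N \<in> C" for d
    using no_cut_in_block[of "j + d" c] that assms by (simp add: add.assoc)
qed

text \<open>If the offsets differed, \<open>c\<close> would be a cut at the positive offset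
  \<open>j' - j\<close> inside the block of \<open>c'\<close>.\<close>

lemma block_start_unique:
  assumes c: "c \<in> C" "c' \<in> C" and "j \<le> j'" "j' < block_length N C c'"
    and eq: "(c + j) mod N = (c' + j') mod N"
  shows "c = c' \<and> j = j'"
proof -
  have "[c + j = (c' + (j' - j)) + j] (mod N)"
    using eq \<open>j \<le> j'\<close> by (simp add: cong_def)
  then have "[c = c' + (j' - j)] (mod N)"
    by (simp only: cong_add_rcancel_nat)
  then have *: "c = (c' + (j' - j)) mod N"
    using c bound by (auto simp: cong_def)
  then have "\<not> 0 < j' - j"
    using no_cut_in_block[of "j' - j" c'] c assms(4) by auto
  then have "j = j'" using \<open>j \<le> j'\<close> by simp
  then show ?thesis using * c bound by auto
qed

lemma bij_betw_blocks:
  "bij_betw (\<lambda>(c, j). (c + j) mod N) (SIGMA c:C. {..<block_length N C c}) {..<N}"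
  unfolding bij_betw_def
proof
  let ?f = "\<lambda>(c, j). (c + j) mod N" and ?S = "SIGMA c:C. {..<block_length N C c}"
  show "inj_on ?f ?S"
  proof (rule inj_onI, clarify)
    fix c j c' j'
    assume "c \<in> C" "c' \<in> C" "j < block_length N C c" "j' < block_length N C c'"
      "(c + j) mod N = (c' + j') mod N"
    then show "c = c' \<and> j = j'"
      using block_start_unique[of c c' j j'] block_start_unique[of c' c j' j] by (metis nle_le)
  qed
  obtain c0 where c0: "c0 \<in> C" "c0 < N" using nonempty bound by auto
  \<comment> \<open>Moving on from the cut \<open>c0\<close> one letter at a time, each new position
    either stays in the current block or is a cut that opens the next one.\<close>
  have covered: "(c0 + d) mod N \<in> ?f ` ?S" for d
  proof (induction d)
    case 0
    have "(c0, 0) \<in> ?S" using c0 block_length_pos by simp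
    then show ?case by (rule rev_image_eqI) simp
  next
    case (Suc d)
    then obtain c j where cj: "c \<in> C" "j < block_length N C c" "(c0 + d) mod N = (c + j) mod N"
      by auto
    then have eq: "(c0 + Suc d) mod N = (c + Suc j) mod N"
      by (metis add_Suc_right mod_Suc_eq)
    show ?case
    proof (cases "Suc j < block_length N C c")
      case True
      then have "(c, Suc j) \<in> ?S" using cj by simp
      then show ?thesis by (rule rev_image_eqI) (simp only: eq prod.case)
    next
      case False
      then have "Suc j = block_length N C c" using cj by simp
      then have "(c0 + Suc d) mod N \<in> C" using eq block_length_cut[of c] by simp
      then have "((c0 + Suc d) mod N, 0) \<in> ?S" using block_length_pos by simp
      then show ?thesis by (rule rev_image_eqI) simp
    qed
  qed
  show "?f ` ?S = {..<N}"
  proof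
    show "?f ` ?S \<subseteq> {..<N}" using c0 by auto
    show "{..<N} \<subseteq> ?f ` ?S"
    proof
      fix i assume "i \<in> {..<N}"
      \<comment> \<open>From \<open>c0\<close>, \<open>N - c0\<close> steps reach position 0 and
        \<open>i\<close> more reach \<open>i\<close>.\<close>
      then have "(c0 + (N - c0 + i)) mod N = i" using c0 by simp
      then show "i \<in> ?f ` ?S" using covered by metis
    qed
  qed
qed

lemma prod_blocks:
  fixes g :: "nat \<Rightarrow> 'a::comm_monoid_mult"
  shows "(\<Prod>i<N. g i) = (\<Prod>c\<in>C. \<Prod>j<block_length N C c. g ((c + j) mod N))"
proof -
  have "finite C" using bound finite_subset by blast
  then show ?thesis
    using prod.reindex_bij_betw[OF bij_betw_blocks, of g]
    by (simp add: prod.Sigma case_prod_beta)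
qed

end

section \<open>Nonzero closed walks and cut sets\<close>

text \<open>Grouping positions by block reduces this to a single block. There the distance to the
  next cut is the number of unread letters, except at the start, where it is 0.\<close>

lemma prod_step_eq_prod_word_poly:
  assumes C: "C \<noteq> {}" "C \<subseteq> {..<length s}"
  defines "q \<equiv> \<lambda>i. state_of (cut_distance (length s) C i)"
  shows "(\<Prod>i<length s. step (s ! i) (q i) (q (Suc i))) = (\<Prod>c\<in>C. word_poly (block s C c))"
  unfolding prod_blocks[OF C]
proof (rule prod.cong)
  fix c assume c: "c \<in> C"
  let ?N = "length s"
  let ?u = "block s C c"
  have len: "length ?u = block_length ?N C c" by (simp add: block_def)
  have "?u \<noteq> []" using block_length_pos[OF C, of c] len by auto
  have "(\<Prod>j<block_length ?N C c. step (s ! ((c + j) mod ?N)) (q ((c + j) mod ?N))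
        (q (Suc ((c + j) mod ?N)))) =
      (\<Prod>j<length ?u. step (?u ! j) (if j = 0 then Cut else state_of (length ?u - j))
        (state_of (length ?u - Suc j)))"
  proof (rule prod.cong)
    fix j assume "j \<in> {..<length ?u}"
    then have j: "j < block_length ?N C c" using len by simp
    have "c mod ?N \<in> C" using c C by auto
    then have "q ((c + j) mod ?N) = (if j = 0 then Cut else state_of (length ?u - j))"
      using j cut_distance_in_block[OF C, of j c] cut_distance_eq_0_iff[OF C, of c]
      by (auto simp: q_def len)
    moreover have "q (Suc ((c + j) mod ?N)) = state_of (length ?u - Suc j)"
      using j cut_distance_in_block[OF C, of "Suc j" c] by (simp add: q_def len)
    moreover have "s ! ((c + j) mod ?N) = ?u ! j" using j by (simp add: block_def)
    ultimately show "step (s ! ((c + j) mod ?N)) (q ((c + j) mod ?N)) (q (Suc ((c + j) mod ?N))) =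
        step (?u ! j) (if j = 0 then Cut else state_of (length ?u - j)) (state_of (length ?u - Suc j))"
      by simp
  qed (simp add: len)
  also have "\<dots> = word_poly ?u" by (rule prod_step_eq_word_poly) fact
  finally show "(\<Prod>j<block_length ?N C c. step (s ! ((c + j) mod ?N)) (q ((c + j) mod ?N))
        (q (Suc ((c + j) mod ?N)))) = word_poly ?u" .
qed simp

text \<open>Choices occur only at \<open>Cut\<close>; from \<open>One\<close> and \<open>Two\<close>
  a nonzero walk counts down to the next cut.\<close>

lemma step_nonzeroD:
  assumes "step l p q \<noteq> 0"
  shows "p = One \<Longrightarrow> q = Cut" "p = Two \<Longrightarrow> q = One"
  using assms by (cases l; cases p; cases q; simp)+

text \<open>By the countdown, a nonzero closed walk is determined by the positions at which it is in
  state \<open>Cut\<close>.\<close>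

lemma nonzero_walk_eq_cut_distance:
  assumes "s \<noteq> []" and closed: "f (length s) = f 0"
    and nz: "\<And>k. k < length s \<Longrightarrow> step (s ! k) (f k) (f (Suc k)) \<noteq> 0"
  defines "C \<equiv> {k. k < length s \<and> f k = Cut}"
  shows "C \<noteq> {}" and "k \<le> length s \<Longrightarrow> f k = state_of (cut_distance (length s) C k)"
proof -
  let ?N = "length s"
  \<comment> \<open>The periodic extension avoids wrap-around cases; closedness of \<open>f\<close>
    makes its steps agree with those of \<open>f\<close>.\<close>
  define g where "g n = f (n mod ?N)" for n
  have g_Suc: "g (Suc n) = f (Suc (n mod ?N))" for n
    using closed by (simp add: g_def mod_Suc)
  have "step (s ! (n mod ?N)) (g n) (g (Suc n)) \<noteq> 0" for n
    using nz[of "n mod ?N"] \<open>s \<noteq> []\<close> by (simp add: g_Suc) (simp add: g_def)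
  note next_state = step_nonzeroD[OF this]
  have mem: "n mod ?N \<in> C \<longleftrightarrow> g n = Cut" for n
    using \<open>s \<noteq> []\<close> by (simp add: C_def g_def)
  \<comment> \<open>From any state, \<open>Cut\<close> is reached within two steps.\<close>
  have "\<exists>n. g n = Cut"
    using next_state by (metis state.exhaust)
  then show "C \<noteq> {}" using mem by blast
  have g: "g n = state_of (cut_distance ?N C n)" for n
  proof (cases "g n")
    case Cut
    then have "cut_distance ?N C n = 0" by (simp add: cut_distance_def mem)
    then show ?thesis using Cut by simp
  next
    case One
    have "cut_distance ?N C n = 1"
      unfolding cut_distance_def mem
    proof (rule Least_equality)
      show "g (n + 1) = Cut" using next_state(1)[OF One] by simp
      show "1 \<le> d" if "g (n + d) = Cut" for d
        using that One by (cases d) auto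
    qed
    then show ?thesis using One by simp
  next
    case Two
    have one: "g (Suc n) = One" using next_state(2)[OF Two] .
    have "cut_distance ?N C n = Suc (Suc 0)"
      unfolding cut_distance_def mem
    proof (rule Least_equality)
      show "g (n + Suc (Suc 0)) = Cut" using next_state(1)[OF one] by simp
      show "Suc (Suc 0) \<le> d" if "g (n + d) = Cut" for d
      proof -
        have "d \<noteq> 0" using that Two by (intro notI) simp
        moreover have "d \<noteq> Suc 0" using that one by (intro notI) simp
        ultimately show ?thesis by simp
      qed
    qed
    then show ?thesis using Two by simp
  qed
  show "f k = state_of (cut_distance ?N C k)" if "k \<le> ?N"
    using that g[of k] closed by (cases "k = ?N") (simp_all add: g_def)
qed

text \<open>Closed walks match nonempty cut sets only where the product of steps is nonzero, so both
  sums are cut down to nonzero terms before they are matched.\<close>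

lemma trace_transfer:
  assumes "s \<noteq> []"
  shows "trace (word_matrix transfer s) =
    (\<Sum>C \<in> Pow {..<length s} - {{}}. \<Prod>c\<in>C. word_poly (block s C c))"
proof -
  let ?N = "length s"
  let ?W = "{f. f \<in> {..?N} \<rightarrow>\<^sub>E (UNIV::state set) \<and> f ?N = f 0}"
  let ?w = "\<lambda>f. \<Prod>k<?N. step (s ! k) (f k) (f (Suc k))"
  let ?walk = "\<lambda>C. restrict (\<lambda>i. state_of (cut_distance ?N C i)) {..?N}"
  let ?cuts = "\<lambda>f. {k. k < ?N \<and> f k = Cut}"
  have "finite ({..?N} \<rightarrow>\<^sub>E (UNIV::state set))" by (rule finite_PiE) auto
  then have fin: "finite ?W" by (rule rev_finite_subset) auto
  have state_of_eq_Cut: "state_of d = Cut \<longleftrightarrow> d = 0" for d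
    by (cases d rule: state_of.cases) auto
  have "(\<Sum>f\<in>?W. ?w f) = (\<Sum>f\<in>{f \<in> ?W. ?w f \<noteq> 0}. ?w f)"
    using fin by (intro sum.mono_neutral_right) auto
  also have "\<dots> = (\<Sum>C \<in> {C \<in> Pow {..<?N} - {{}}. ?w (?walk C) \<noteq> 0}. ?w (?walk C))"
  proof (rule sum.reindex_bij_witness[where i = ?walk and j = ?cuts])
    fix f assume "f \<in> {f \<in> ?W. ?w f \<noteq> 0}"
    then have f: "f \<in> {..?N} \<rightarrow>\<^sub>E UNIV" "f ?N = f 0" and nz: "?w f \<noteq> 0" by auto
    have "step (s ! k) (f k) (f (Suc k)) \<noteq> 0" if "k < ?N" for k
      using nz that by auto
    note cuts = nonzero_walk_eq_cut_distance[of s f, OF assms f(2) this, simplified]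
    show walk: "?walk (?cuts f) = f"
      using cuts(2) f(1) by (auto simp: fun_eq_iff PiE_iff extensional_def restrict_def)
    show "?cuts f \<in> {C \<in> Pow {..<?N} - {{}}. ?w (?walk C) \<noteq> 0}"
      unfolding mem_Collect_eq walk using nz cuts(1) by auto
    show "?w (?walk (?cuts f)) = ?w f" unfolding walk ..
  next
    fix C assume "C \<in> {C \<in> Pow {..<?N} - {{}}. ?w (?walk C) \<noteq> 0}"
    then have C: "C \<noteq> {}" "C \<subseteq> {..<?N}" and nz: "?w (?walk C) \<noteq> 0" by auto
    show "?cuts (?walk C) = C"
      using C(2) cut_distance_eq_0_iff[OF C] by (auto simp: state_of_eq_Cut)
    \<comment> \<open>The walk closes up because 0 and \<open>?N\<close> are the same point of the
      circle.\<close>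
    have "cut_distance ?N C ?N = cut_distance ?N C 0"
      using cut_distance_mod[of ?N C ?N] by simp
    then show "?walk C \<in> {f \<in> ?W. ?w f \<noteq> 0}" using nz by auto
  qed
  also have "\<dots> = (\<Sum>C \<in> Pow {..<?N} - {{}}. ?w (?walk C))"
    by (intro sum.mono_neutral_left) auto
  also have "\<dots> = (\<Sum>C \<in> Pow {..<?N} - {{}}. \<Prod>c\<in>C. word_poly (block s C c))"
  proof (rule sum.cong)
    fix C assume "C \<in> Pow {..<?N} - {{}}"
    then have C: "C \<noteq> {}" "C \<subseteq> {..<?N}" by auto
    have "?w (?walk C) = ?w (\<lambda>i. state_of (cut_distance ?N C i))"
      by (intro prod.cong) auto
    then show "?w (?walk C) = (\<Prod>c\<in>C. word_poly (block s C c))"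
      using prod_step_eq_prod_word_poly[OF C] by simp
  qed simp
  finally show ?thesis
    by (simp add: trace_word_matrix transfer_def)
qed

section \<open>The sentence polynomial as a trace\<close>

lemma prod_monom: "(\<Prod>x\<in>S. monom (a x) (n x)) = monom (prod a S) (sum n S)"
  for a :: "'a \<Rightarrow> 'b::comm_semiring_1"
  by (induction S rule: infinite_finite_induct) (auto simp: mult_monom)

text \<open>The empty list must be excluded: it has no parsing, but its trace is 3.\<close>

lemma sentence_poly_eq_trace:
  assumes "s \<noteq> []"
  shows "sentence_poly (abs_cyclic_sentence s) = trace (word_matrix transfer s)"
proof -
  have fin: "finite (parsings s)"
    by (rule finite_subset[of _ "Pow {..<length s}"]) (auto simp: parsings_def)
  have "sentence_poly (abs_cyclic_sentence s) =
      (\<Sum>C\<in>parsings s. monom (parsing_coeff s C) (parsing_weight s C))"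
    using fin by (intro poly_eqI)
      (simp add: coeff_sentence_poly weight_coeff.abs_eq coeff_sum sum.inter_filter)
  also have "\<dots> = (\<Sum>C\<in>parsings s. \<Prod>c\<in>C. word_poly (block s C c))"
  proof (rule sum.cong)
    fix C assume "C \<in> parsings s"
    then have "(\<Prod>c\<in>C. word_poly (block s C c)) =
        (\<Prod>c\<in>C. monom (word_coeff (block s C c)) (word_weight (block s C c)))"
      by (intro prod.cong) (auto simp: parsings_def word_poly_def)
    then show "monom (parsing_coeff s C) (parsing_weight s C) = (\<Prod>c\<in>C. word_poly (block s C c))"
      by (simp add: prod_monom parsing_coeff_def parsing_weight_def)
  qed simp
  \<comment> \<open>\<open>word_poly\<close> vanishes on non-words, so a cut set that is no parsing
    contributes 0.\<close>
  also have "\<dots> = (\<Sum>C \<in> Pow {..<length s} - {{}}. \<Prod>c\<in>C. word_poly (block s C c))"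
  proof (rule sum.mono_neutral_left)
    show "\<forall>C \<in> Pow {..<length s} - {{}} - parsings s. (\<Prod>c\<in>C. word_poly (block s C c)) = 0"
    proof
      fix C assume C: "C \<in> Pow {..<length s} - {{}} - parsings s"
      then obtain c where "c \<in> C" "\<not> is_word (block s C c)"
        by (auto simp: parsings_def)
      moreover have "finite C" using C finite_subset by auto
      ultimately show "(\<Prod>c\<in>C. word_poly (block s C c)) = 0"
        by (auto simp: word_poly_def intro!: prod_zero)
    qed
  qed (auto simp: parsings_def)
  finally show ?thesis using trace_transfer[OF assms] by simp
qed

section \<open>The symmetrizing matrix and reversal\<close>

text \<open>For symmetric \<open>P\<close> the required identity says that
  \<open>P ** transfer l\<close> is symmetric, a linear system in the entries of \<open>P\<close>.
  The letters \<open>A\<close> and \<open>B\<close> fix them up to a common factor, normalised by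
  the entry 1 at \<open>Cut\<close>, \<open>Cut\<close>; the letter \<open>X\<close> is then
  compatible.\<close>

fun symmetrizer :: "state \<Rightarrow> state \<Rightarrow> int poly" where
  "symmetrizer Cut Cut = 1"
| "symmetrizer One One = [:0, 1:]"
| "symmetrizer Two Two = [:0, 0, 1:]"
| "symmetrizer Cut Two = [:0, 1:]"
| "symmetrizer Two Cut = [:0, 1:]"
| "symmetrizer _ _ = [:0, -1:]"

text \<open>The adjugate of \<open>symmetrizer\<close> divided by the common factor \<open>t (1 - t)\<close> of its entries.\<close>

fun cosymmetrizer :: "state \<Rightarrow> state \<Rightarrow> int poly" where
  "cosymmetrizer Cut Two = 0"
| "cosymmetrizer Two Cut = 0"
| "cosymmetrizer One One = 0"
| "cosymmetrizer Cut _ = [:0, -1:]"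
| "cosymmetrizer One Cut = [:0, -1:]"
| "cosymmetrizer _ _ = 1"

lemma trace_transfer_rev: "trace (word_matrix transfer (rev s)) = trace (word_matrix transfer s)"
proof (rule trace_word_matrix_rev)
  let ?P = "(\<chi> i j. symmetrizer i j) :: int poly^state^state"
  let ?R = "(\<chi> i j. cosymmetrizer i j) :: int poly^state^state"
  have all: "(\<forall>i. Q i) \<longleftrightarrow> Q Cut \<and> Q One \<and> Q Two" for Q
    by (metis state.exhaust)
  show "?P ** transfer l = transpose (transfer l) ** ?P" for l
    by (cases l) (simp_all add: vec_eq_iff all matrix_matrix_mult_def transpose_def transfer_def
        UNIV_state numeral_poly one_pCons)
  \<comment> \<open>The scalar is t^2 - t: the determinant of \<open>?P\<close> is -t^2 (1 - t)^2,
    and t (1 - t) has been divided out of the adjugate.\<close>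
  show "?P ** ?R = mat [:0, -1, 1:]" "?R ** ?P = mat [:0, -1, 1:]"
    by (simp_all add: vec_eq_iff all matrix_matrix_mult_def mat_def UNIV_state one_pCons)
qed simp

theorem theorem4p1:
  fixes N :: nat and S :: cyclic_sentence
  assumes "N \<ge> 1" and "sentence_length S = N"
  shows "sentence_poly S = sentence_poly (reversed S)"
proof -
  obtain s where S: "S = abs_cyclic_sentence s"
    by (metis Quotient3_abs_rep Quotient3_cyclic_sentence)
  have "s \<noteq> []" using assms by (auto simp: S sentence_length.abs_eq)
  then show ?thesis
    by (simp add: S reversed.abs_eq sentence_poly_eq_trace trace_transfer_rev)
qed

end
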